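(* Consider the time scale $\mathbb{Z}$ with $a=0$, $b=n$. Suppose that (1) $I_k: 0=j_0<j_1<\cdots<j_{k-1}<j_k=n$ is a division of $[0,n]\cap\mathbb{Z}$ for $j_0,j_1,\dots,j_k\in\mathbb{Z}$; (2) $p_i\in\mathbb{Z}$ $(i=0,\dots,k+1)$ are $k+2$ points such that $p_0=0$, $p_i\in[j_{i-1},j_i]\cap\mathbb{Z}$ $(i=1,\dots,k)$ and $p_{k+1}=n$; (3) $f:[0,n]\cap\mathbb{Z}\to\mathbb{R}$ is written as $f(k)=x_k$. Then $$\left|\sum_{j=1}^n x_j-\sum_{i=0}^k(p_{i+1}-p_i)x_{j_i}\right|\le M\left(\frac14\sum_{i=0}^{k-1}(j_{i+1}-j_i)^2+\sum_{i=0}^{k-1}\left(p_{i+1}-\frac{j_i+j_{i+1}}{2}\right)^2+\sum_{i=0}^{k-1}\left(p_{i+1}-\frac{j_i+j_{i+1}}{2}\right)\right),$$ where $M=\sup_{i=1,\dots,n-1}|\Delta x_i|$, and the constant $\frac14$ in the right-hand side is the best possible.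
   Context: $\Delta x_i=x_{i+1}-x_i$ denotes the forward difference. In (3), $k$ is a running index for the real numbers $x_0,x_1,\dots,x_n$, not the number of subintervals of the division.
   Formalization: The supremum M is taken over i=0,…,n−1 instead of i=1,…,n−1, since as printed the inequality fails (n=2, k=1, p_1=1, x=(1,0,0): left side 1, M=0); n>0 is assumed. *)

theory Defs
  imports Complex_Main
begin

definition division :: "int \<Rightarrow> nat \<Rightarrow> (nat \<Rightarrow> int) \<Rightarrow> bool" where
  "division n k j \<longleftrightarrow> j 0 = 0 \<and> j k = n \<and> (\<forall>i<k. j i < j (i + 1))"

definition intermediate_points :: "int \<Rightarrow> nat \<Rightarrow> (nat \<Rightarrow> int) \<Rightarrow> (nat \<Rightarrow> int) \<Rightarrow> bool" where
  "intermediate_points n k j p \<longleftrightarrow>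
     p 0 = 0 \<and> (\<forall>i\<in>{1..k}. p i \<in> {j (i - 1)..j i}) \<and> p (k + 1) = n"

definition forward_diff :: "(int \<Rightarrow> real) \<Rightarrow> int \<Rightarrow> real" where
  "forward_diff x i = x (i + 1) - x i"

text \<open>
  The index 0 has to be included: otherwise, for n = 2, k = 1, p 1 = 1, x 0 = 1 and
  x 1 = x 2 = 0, the supremum would be 0, while the left-hand side of the inequality
  below equals 1.
\<close>

definition sup_forward_diff :: "int \<Rightarrow> (int \<Rightarrow> real) \<Rightarrow> real" where
  "sup_forward_diff n x = (SUP i\<in>{0..n - 1}. \<bar>forward_diff x i\<bar>)"

text \<open>
  Sequences are total functions on the integers, but only their values on the integers
  from 0 to n matter here.
\<close>

definition ostrowski_ineq ::
    "real \<Rightarrow> int \<Rightarrow> nat \<Rightarrow> (nat \<Rightarrow> int) \<Rightarrow> (nat \<Rightarrow> int) \<Rightarrow> (int \<Rightarrow> real) \<Rightarrow> bool" where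
  "ostrowski_ineq c n k j p x \<longleftrightarrow>
     \<bar>(\<Sum>t\<in>{1..n}. x t) - (\<Sum>i=0..k. real_of_int (p (i + 1) - p i) * x (j i))\<bar>
     \<le> sup_forward_diff n x *
        (c * (\<Sum>i<k. (real_of_int (j (i + 1) - j i))\<^sup>2)
         + (\<Sum>i<k. (real_of_int (p (i + 1)) - real_of_int (j i + j (i + 1)) / 2)\<^sup>2)
         + (\<Sum>i<k. real_of_int (p (i + 1)) - real_of_int (j i + j (i + 1)) / 2))"

end

theory Submission
  imports Defs
begin

text \<open>
  On a single subinterval with endpoints \<open>a \<le> b\<close> and intermediate point \<open>q\<close>, the error of the
  quadrature rule is the sum of \<open>x t - x a\<close> over \<open>a < t \<le> q\<close> and of \<open>x t - x b\<close> over
  \<open>q < t \<le> b\<close>. Bounding these differences by \<open>M (t - a)\<close> and \<open>M (b - t)\<close> and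
  summing gives, with \<open>u = q - a\<close> and \<open>v = b - q\<close>, the bound
  \<open>M (u (u + 1) + v (v - 1)) / 2\<close>, which equals
  \<open>M ((u + v)\<^sup>2 / 4 + ((u - v) / 2)\<^sup>2 + (u - v) / 2)\<close>. The estimate is an equality for
  \<open>x t = t\<close> on the trivial division with \<open>p 1 = n\<close>, so the constant is optimal.
\<close>

lemma sum_atLeastAtMost_int_Suc:
  fixes f :: "int \<Rightarrow> 'a::comm_monoid_add"
  assumes "a \<le> b + 1"
  shows "(\<Sum>t\<in>{a..b + 1}. f t) = (\<Sum>t\<in>{a..b}. f t) + f (b + 1)"
proof -
  have "{a..b + 1} = insert (b + 1) {a..b}"
    using assms by auto
  then show ?thesis
    by (simp add: add.commute)
qed

text \<open>Blocks have the half-open form \<open>{a + 1..b}\<close>, so that adjacent ones share no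
  endpoint and the sum over \<open>{1..n}\<close>, which omits \<open>x 0\<close>, splits exactly
  along the division points.\<close>

lemma sum_atLeastAtMost_int_concat:
  fixes f :: "int \<Rightarrow> 'a::comm_monoid_add"
  assumes "a \<le> b" "b \<le> c"
  shows "(\<Sum>t\<in>{a + 1..c}. f t) = (\<Sum>t\<in>{a + 1..b}. f t) + (\<Sum>t\<in>{b + 1..c}. f t)"
proof -
  have "{a + 1..c} = {a + 1..b} \<union> {b + 1..c}"
    using assms by auto
  then show ?thesis
    by (simp add: sum.union_disjoint)
qed

lemma forward_diff_bound_imp_lipschitz:
  assumes "a \<le> b" "\<And>i. a \<le> i \<Longrightarrow> i < b \<Longrightarrow> \<bar>forward_diff x i\<bar> \<le> M"
  shows "\<bar>x b - x a\<bar> \<le> M * real_of_int (b - a)"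
  using assms
proof (induction b rule: int_ge_induct)
  case base
  then show ?case by simp
next
  case (step b)
  have "\<bar>x b - x a\<bar> \<le> M * real_of_int (b - a)"
    using step by auto
  moreover have "\<bar>x (b + 1) - x b\<bar> \<le> M"
    using step.prems[of b] step.hyps by (simp add: forward_diff_def)
  ultimately show ?case
    by (simp add: algebra_simps)
qed

lemma left_rectangle_error:
  assumes "a \<le> b" "\<And>i. a \<le> i \<Longrightarrow> i < b \<Longrightarrow> \<bar>forward_diff x i\<bar> \<le> M"
  shows "\<bar>(\<Sum>t\<in>{a + 1..b}. x t) - real_of_int (b - a) * x a\<bar>
           \<le> M * (real_of_int (b - a) * (real_of_int (b - a) + 1) / 2)"
  using assms
proof (induction b rule: int_ge_induct)
  case base
  then show ?case by simp
next
  case (step b)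
  let ?u = "real_of_int (b - a)"
  have "\<bar>(\<Sum>t\<in>{a + 1..b}. x t) - ?u * x a\<bar> \<le> M * (?u * (?u + 1) / 2)"
    using step by auto
  moreover have "\<bar>x (b + 1) - x a\<bar> \<le> M * (?u + 1)"
    using forward_diff_bound_imp_lipschitz[of a "b + 1" x M] step.prems step.hyps
    by (simp add: algebra_simps)
  moreover have "(\<Sum>t\<in>{a + 1..b + 1}. x t) - real_of_int (b + 1 - a) * x a
      = ((\<Sum>t\<in>{a + 1..b}. x t) - ?u * x a) + (x (b + 1) - x a)"
    using sum_atLeastAtMost_int_Suc[of "a + 1" b x] step.hyps by (simp add: algebra_simps)
  moreover have "M * (real_of_int (b + 1 - a) * (real_of_int (b + 1 - a) + 1) / 2)
      = M * (?u * (?u + 1) / 2) + M * (?u + 1)"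
    by (simp add: field_simps)
  ultimately show ?case
    by linarith
qed

text \<open>The distances \<open>b - t\<close> run from 0 to \<open>b - a - 1\<close>, while the
  distances to the left endpoint run from 1 to \<open>b - a\<close>. This asymmetry is the source of
  the unsquared term in the final bound.\<close>

lemma right_rectangle_error:
  assumes "a \<le> b" "\<And>i. a \<le> i \<Longrightarrow> i < b \<Longrightarrow> \<bar>forward_diff x i\<bar> \<le> M"
  shows "\<bar>(\<Sum>t\<in>{a + 1..b}. x t) - real_of_int (b - a) * x b\<bar>
           \<le> M * (real_of_int (b - a) * (real_of_int (b - a) - 1) / 2)"
  using assms
proof (induction b rule: int_ge_induct)
  case base
  then show ?case by simp
next
  case (step b)
  let ?u = "real_of_int (b - a)"
  have "\<bar>(\<Sum>t\<in>{a + 1..b}. x t) - ?u * x b\<bar> \<le> M * (?u * (?u - 1) / 2)"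
    using step by auto
  \<comment> \<open>Moving the right endpoint to \<open>b + 1\<close> replaces the reference value
    \<open>x b\<close> in all \<open>b - a\<close> old summands, while the new summand equals its
    reference value and adds no error.\<close>
  moreover have "\<bar>?u * (x (b + 1) - x b)\<bar> \<le> M * ?u"
  proof -
    have "\<bar>x (b + 1) - x b\<bar> \<le> M"
      using step.prems[of b] step.hyps by (simp add: forward_diff_def)
    then have "?u * \<bar>x (b + 1) - x b\<bar> \<le> ?u * M"
      using step.hyps by (intro mult_left_mono) auto
    then show ?thesis
      using step.hyps by (simp add: abs_mult mult.commute)
  qed
  moreover have "(\<Sum>t\<in>{a + 1..b + 1}. x t) - real_of_int (b + 1 - a) * x (b + 1)
      = ((\<Sum>t\<in>{a + 1..b}. x t) - ?u * x b) - ?u * (x (b + 1) - x b)"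
    using sum_atLeastAtMost_int_Suc[of "a + 1" b x] step.hyps by (simp add: algebra_simps)
  moreover have "M * (real_of_int (b + 1 - a) * (real_of_int (b + 1 - a) - 1) / 2)
      = M * (?u * (?u - 1) / 2) + M * ?u"
    by (simp add: field_simps)
  ultimately show ?case
    by linarith
qed

lemma subinterval_error:
  assumes "a \<le> q" "q \<le> b" "\<And>i. a \<le> i \<Longrightarrow> i < b \<Longrightarrow> \<bar>forward_diff x i\<bar> \<le> M"
  shows "\<bar>(\<Sum>t\<in>{a + 1..b}. x t)
            - (real_of_int (q - a) * x a + real_of_int (b - q) * x b)\<bar>
         \<le> M * (1 / 4 * (real_of_int (b - a))\<^sup>2
                + (real_of_int q - real_of_int (a + b) / 2)\<^sup>2
                + (real_of_int q - real_of_int (a + b) / 2))"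
proof -
  have "\<bar>(\<Sum>t\<in>{a + 1..q}. x t) - real_of_int (q - a) * x a\<bar>
      \<le> M * (real_of_int (q - a) * (real_of_int (q - a) + 1) / 2)"
    using assms by (intro left_rectangle_error) auto
  moreover have "\<bar>(\<Sum>t\<in>{q + 1..b}. x t) - real_of_int (b - q) * x b\<bar>
      \<le> M * (real_of_int (b - q) * (real_of_int (b - q) - 1) / 2)"
    using assms by (intro right_rectangle_error) auto
  moreover have "M * (1 / 4 * (real_of_int (b - a))\<^sup>2
                + (real_of_int q - real_of_int (a + b) / 2)\<^sup>2
                + (real_of_int q - real_of_int (a + b) / 2))
      = M * (real_of_int (q - a) * (real_of_int (q - a) + 1) / 2)
        + M * (real_of_int (b - q) * (real_of_int (b - q) - 1) / 2)"
    by (simp add: field_simps power2_eq_square)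
  moreover note sum_atLeastAtMost_int_concat[OF assms(1,2), of x]
  ultimately show ?thesis
    by linarith
qed

text \<open>The inequality is carried through the induction together with the sum because appending
  a block requires \<open>j 0 \<le> j k\<close>.\<close>

lemma sum_division_concat:
  fixes f :: "int \<Rightarrow> 'a::comm_monoid_add" and j :: "nat \<Rightarrow> int"
  assumes "\<And>i. i < k \<Longrightarrow> j i \<le> j (i + 1)"
  shows "j 0 \<le> j k \<and> (\<Sum>t\<in>{j 0 + 1..j k}. f t) = (\<Sum>i<k. \<Sum>t\<in>{j i + 1..j (i + 1)}. f t)"
  using assms
proof (induction k)
  case 0
  then show ?case by simp
next
  case (Suc k)
  have "j 0 \<le> j k"
    and "(\<Sum>t\<in>{j 0 + 1..j k}. f t) = (\<Sum>i<k. \<Sum>t\<in>{j i + 1..j (i + 1)}. f t)"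
    using Suc by auto
  moreover have "j k \<le> j (Suc k)"
    using Suc.prems[of k] by simp
  ultimately show ?case
    using sum_atLeastAtMost_int_concat[of "j 0" "j k" "j (Suc k)" f] by simp
qed

text \<open>Each weight splits at its node as
  \<open>p (i + 1) - p i = (p (i + 1) - j i) + (j i - p i)\<close>, and the two parts go to the
  subintervals right and left of \<open>j i\<close>. The last summand vanishes once
  \<open>p (k + 1) = j k\<close>.\<close>

lemma quadrature_sum_by_parts:
  fixes j p :: "nat \<Rightarrow> int" and x :: "int \<Rightarrow> real"
  assumes "p 0 = j 0"
  shows "(\<Sum>i=0..k. real_of_int (p (i + 1) - p i) * x (j i))
       = (\<Sum>i<k. real_of_int (p (i + 1) - j i) * x (j i)
                 + real_of_int (j (i + 1) - p (i + 1)) * x (j (i + 1)))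
         + real_of_int (p (k + 1) - j k) * x (j k)"
  using assms by (induction k) (simp_all add: algebra_simps)

lemma division_mono:
  assumes "division n k j" "i \<le> l" "l \<le> k"
  shows "j i \<le> j l"
  using assms(2,3)
proof (induction l rule: dec_induct)
  case base
  then show ?case by simp
next
  case (step l)
  then have "j l < j (l + 1)"
    using assms(1) unfolding division_def by auto
  then show ?case
    using step by simp
qed

text \<open>The real supremum bounds its family from above because the index set is finite.\<close>

lemma forward_diff_le_sup:
  assumes "0 \<le> i" "i < n"
  shows "\<bar>forward_diff x i\<bar> \<le> sup_forward_diff n x"
  unfolding sup_forward_diff_def using assms by (intro cSUP_upper) auto

lemma ostrowski_ineq_quarter:
  assumes "division n k j" "intermediate_points n k j p"
  shows "ostrowski_ineq (1 / 4) n k j p x"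
proof -
  let ?e = "\<lambda>i. (\<Sum>t\<in>{j i + 1..j (i + 1)}. x t)
      - (real_of_int (p (i + 1) - j i) * x (j i)
         + real_of_int (j (i + 1) - p (i + 1)) * x (j (i + 1)))"
  let ?r = "\<lambda>i. 1 / 4 * (real_of_int (j (i + 1) - j i))\<^sup>2
      + (real_of_int (p (i + 1)) - real_of_int (j i + j (i + 1)) / 2)\<^sup>2
      + (real_of_int (p (i + 1)) - real_of_int (j i + j (i + 1)) / 2)"
  have ends: "j 0 = 0" "j k = n" "p 0 = 0" "p (k + 1) = n"
    using assms unfolding division_def intermediate_points_def by auto
  have local_error: "\<bar>?e i\<bar> \<le> sup_forward_diff n x * ?r i" if "i < k" for i
  proof (rule subinterval_error)
    have "p (i + 1) \<in> {j (i + 1 - 1)..j (i + 1)}"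
      using assms(2) that unfolding intermediate_points_def by force
    then show "j i \<le> p (i + 1)" "p (i + 1) \<le> j (i + 1)"
      by auto
    have "0 \<le> j i" "j (i + 1) \<le> n"
      using division_mono[OF assms(1), of 0 i] division_mono[OF assms(1), of "i + 1" k] that ends
      by auto
    then show "\<bar>forward_diff x l\<bar> \<le> sup_forward_diff n x" if "j i \<le> l" "l < j (i + 1)" for l
      using that by (intro forward_diff_le_sup) auto
  qed
  have "(\<Sum>t\<in>{1..n}. x t) = (\<Sum>i<k. \<Sum>t\<in>{j i + 1..j (i + 1)}. x t)"
    using sum_division_concat[of k j x] division_mono[OF assms(1)] ends by simp
  \<comment> \<open>With the weights regrouped by subinterval, the global error is the sum of the
    local ones, so the triangle inequality finishes the bound.\<close>
  then have "(\<Sum>t\<in>{1..n}. x t) - (\<Sum>i=0..k. real_of_int (p (i + 1) - p i) * x (j i))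
      = (\<Sum>i<k. ?e i)"
    using quadrature_sum_by_parts[of p j x k] ends by (simp add: sum_subtractf)
  moreover have "\<bar>\<Sum>i<k. ?e i\<bar> \<le> (\<Sum>i<k. sup_forward_diff n x * ?r i)"
    by (rule order_trans[OF sum_abs]) (use local_error in \<open>auto intro: sum_mono\<close>)
  moreover have "(\<Sum>i<k. sup_forward_diff n x * ?r i) = sup_forward_diff n x *
        (1 / 4 * (\<Sum>i<k. (real_of_int (j (i + 1) - j i))\<^sup>2)
         + (\<Sum>i<k. (real_of_int (p (i + 1)) - real_of_int (j i + j (i + 1)) / 2)\<^sup>2)
         + (\<Sum>i<k. real_of_int (p (i + 1)) - real_of_int (j i + j (i + 1)) / 2))"
    unfolding sum_distrib_left sum.distrib[symmetric] by simp
  ultimately show ?thesis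
    unfolding ostrowski_ineq_def by simp
qed

lemma sum_of_int_atLeastAtMost:
  assumes "0 \<le> n"
  shows "(\<Sum>t\<in>{1..n}. real_of_int t) = real_of_int n * (real_of_int n + 1) / 2"
  using assms
proof (induction n rule: int_ge_induct)
  case base
  then show ?case by simp
next
  case (step n)
  then show ?case
    using sum_atLeastAtMost_int_Suc[of 1 n real_of_int] by (simp add: field_simps)
qed

text \<open>Since \<open>n\<close> is fixed, the constant is optimal for every length separately,
  not merely over all lengths together.\<close>

lemma ostrowski_const_ge_quarter:
  assumes "0 < n"
    and ineq: "\<And>k j p x. division n k j \<Longrightarrow> intermediate_points n k j p \<Longrightarrow> ostrowski_ineq c n k j p x"
  shows "1 / 4 \<le> c"
proof -
  \<comment> \<open>One function serves as both \<open>j\<close> and \<open>p\<close>: the nodes are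
    0 and \<open>n\<close>, and \<open>p 1 = p 2 = n\<close>. All the weight falls on node 0, so for
    the identity sequence the quadrature sum is 0.\<close>
  let ?j = "\<lambda>i::nat. if i = 0 then 0 else n"
  let ?n = "real_of_int n"
  have "ostrowski_ineq c n 1 ?j ?j real_of_int"
    using assms(1) by (intro ineq) (auto simp: division_def intermediate_points_def)
  moreover have "sup_forward_diff n real_of_int = 1"
    using assms(1) by (simp add: sup_forward_diff_def forward_diff_def)
  ultimately have "?n * (?n + 1) / 2 \<le> c * ?n\<^sup>2 + (?n / 2)\<^sup>2 + ?n / 2"
    using assms(1) by (simp add: ostrowski_ineq_def sum_of_int_atLeastAtMost)
  \<comment> \<open>The linear terms \<open>?n / 2\<close> cancel, and the squared midpoint
    deviation accounts for a quarter of \<open>?n\<^sup>2\<close> out of the half on the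
    left.\<close>
  then have "1 / 4 * ?n\<^sup>2 \<le> c * ?n\<^sup>2"
    by (simp add: field_simps power2_eq_square)
  then show ?thesis
    using assms(1) by (simp only: mult_le_cancel_right) auto
qed

theorem corollary2:
  fixes n :: int
  assumes "0 < n"
  shows "(\<forall>k j p x. division n k j \<and> intermediate_points n k j p
            \<longrightarrow> ostrowski_ineq (1 / 4) n k j p x)
       \<and> (\<forall>c. (\<forall>k j p x. division n k j \<and> intermediate_points n k j p
                  \<longrightarrow> ostrowski_ineq c n k j p x)
            \<longrightarrow> 1 / 4 \<le> c)"
  using ostrowski_ineq_quarter ostrowski_const_ge_quarter[OF assms] by blast

end
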